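(* For any integer $s\ge 4$, \[R_2(s)\le\frac{\gamma s}{3(s-1)},\] where $\gamma$ denotes the optimal value of the quadratic program $\mathcal{Q}$: maximize $\tfrac12\mathbf{z}C\mathbf{z}^T$ over $\mathbf{z}=(z_1,\dots,z_{15})\in\mathbb{R}^{15}$ subject to $\sum_{i=1}^{15}z_i\le 1$ and $z_i\ge 0$ for all $1\le i\le 15$.
   Context: All invertibility is over $\mathbb{F}_2$. For an $s\times s$ invertible $0$-$1$ matrix $M$, $N_2(M)$ is the number of invertible $2\times2$ submatrices of $M$ (one for each choice of two rows and two columns), $R_2(M)=N_2(M)/\binom{s}{2}^2$, and $R_2(s)=\max\{R_2(M): M \text{ is an } s\times s \text{ invertible } 0\text{-}1 \text{ matrix}\}$. For $1\le i\le 15$, $b_i\in\{0,1\}^4$ is the 4-bit binary representation of $i$ ($b_1=(0,0,0,1)$, $b_2=(0,0,1,0)$, $b_3=(0,0,1,1)$, ..., $b_{15}=(1,1,1,1)$). $C=(c_{ij})$ is the $15\times15$ symmetric matrix in which $c_{ij}$ is the number of invertible $2\times 2$ submatrices (choices of two of the four rows) of the $4\times 2$ matrix with columns $b_i^T$ and $b_j^T$. *)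

theory Defs
  imports
    "HOL.Real"
    "HOL-Library.Z2"
    "Jordan_Normal_Form.Matrix"
    "Jordan_Normal_Form.DL_Submatrix"
begin

text \<open>
  Zero-one matrices are matrices over the two-element field \<open>bit\<close>, so that
  \<open>invertible_mat\<close> means invertibility over that field.
\<close>

definition N2 :: "bit mat \<Rightarrow> nat" where
  "N2 M = card {(I, J). I \<subseteq> {..<dim_row M} \<and> card I = 2 \<and>
                       J \<subseteq> {..<dim_col M} \<and> card J = 2 \<and>
                       invertible_mat (submatrix M I J)}"

definition R2_mat :: "bit mat \<Rightarrow> real" where
  "R2_mat M = real (N2 M) / (real (dim_row M choose 2))\<^sup>2"

text \<open>The set below is finite, and nonempty because it contains the value at the identity matrix.\<close>

definition R2 :: "nat \<Rightarrow> real" where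
  "R2 s = Max {R2_mat M | M. M \<in> carrier_mat s s \<and> invertible_mat M}"

text \<open>
  The four binary digits of \<open>i\<close>, most significant digit first; the \<open>bit\<close> on the right-hand
  side is the digit-test operation of the same name as the type.
\<close>

definition bvec :: "nat \<Rightarrow> bit vec" where
  "bvec i = vec 4 (\<lambda>k. of_bool (bit i (3 - k)))"

definition c :: "nat \<Rightarrow> nat \<Rightarrow> nat" where
  "c i j = N2 (mat_of_cols 4 [bvec i, bvec j])"

text \<open>Matrix and vector positions count from 0, hence the shift to the indices 1 to 15.\<close>

definition Cmat :: "real mat" where
  "Cmat = mat 15 15 (\<lambda>(i, j). real (c (Suc i) (Suc j)))"

definition Q_feasible :: "real vec set" where
  "Q_feasible = {z \<in> carrier_vec 15. (\<Sum>i<15. z $ i) \<le> 1 \<and> (\<forall>i<15. 0 \<le> z $ i)}"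

definition Q_objective :: "real vec \<Rightarrow> real" where
  "Q_objective z = 1 / 2 * (z \<bullet> (Cmat *\<^sub>v z))"

text \<open>
  The objective is continuous and the feasible region is nonempty and compact, so the supremum
  is a maximum.
\<close>

definition Q_optimum :: real where
  "Q_optimum = (SUP z\<in>Q_feasible. Q_objective z)"

end

theory Submission
  imports Defs
begin

text \<open>
  Average over the 4-subsets \<open>S\<close> of the rows: every 2-subset of the rows lies in
  \<open>s - 2 choose 2\<close> of them. The \<open>s\<close> columns of the \<open>4 \<times> s\<close> matrix on the rows \<open>S\<close> are classified
  by their value in \<open>{0,1}\<^sup>4\<close>. If \<open>z\<^sub>i\<close> is the proportion of columns equal to \<open>b\<^sub>i\<close>, then \<open>z\<close> is
  feasible and the number of invertible \<open>2 \<times> 2\<close> submatrices on these rows is \<open>s\<^sup>2\<close> times the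
  objective at \<open>z\<close>, since zero columns and pairs of equal columns contribute nothing.
\<close>

section \<open>Invertible 2 by 2 submatrices as sums over ordered index pairs\<close>

text \<open>The diagonal contributes zero and each 2-subset arises from exactly two ordered pairs.
  With ordered pairs, sums over rows and columns can be exchanged and reindexed freely.\<close>

lemma sum_ordered_pairs:
  fixes g :: "'a set \<Rightarrow> real"
  assumes fin: "finite A"
    and g: "\<And>a b. a \<in> A \<Longrightarrow> b \<in> A \<Longrightarrow> a \<noteq> b \<Longrightarrow> g {a, b} = f a b"
    and diag: "\<And>a. a \<in> A \<Longrightarrow> f a a = 0"
  shows "(\<Sum>a\<in>A. \<Sum>b\<in>A. f a b) = 2 * (\<Sum>I | I \<subseteq> A \<and> card I = 2. g I)"
proof -
  let ?P = "{p \<in> A \<times> A. fst p \<noteq> snd p}"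
  let ?T = "{I. I \<subseteq> A \<and> card I = 2}"
  have "(\<Sum>a\<in>A. \<Sum>b\<in>A. f a b) = (\<Sum>p\<in>A \<times> A. f (fst p) (snd p))"
    by (simp add: sum.cartesian_product case_prod_unfold)
  also have "\<dots> = (\<Sum>p\<in>?P. f (fst p) (snd p))"
    using fin diag by (intro sum.mono_neutral_right) auto
  also have "\<dots> = (\<Sum>p\<in>?P. g {fst p, snd p})"
    using g by (intro sum.cong) auto
  also have "\<dots> = (\<Sum>I\<in>?T. \<Sum>p | p \<in> ?P \<and> {fst p, snd p} = I. g {fst p, snd p})"
    using fin by (intro sum.group[symmetric]) auto
  also have "\<dots> = (\<Sum>I\<in>?T. 2 * g I)"
  proof (rule sum.cong[OF refl])
    fix I assume I: "I \<in> ?T"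
    then obtain a b where ab: "I = {a, b}" "a \<noteq> b" by (auto simp: card_2_iff)
    have "{p. p \<in> ?P \<and> {fst p, snd p} = I} = {(a, b), (b, a)}"
      using I ab by (auto simp: doubleton_eq_iff)
    then show "(\<Sum>p | p \<in> ?P \<and> {fst p, snd p} = I. g {fst p, snd p}) = 2 * g I"
      using ab by (simp add: insert_commute)
  qed
  finally show ?thesis by (simp add: sum_distrib_left)
qed

text \<open>The determinant criterion: necessity is multiplicativity of the determinant, sufficiency
  the adjugate formula.\<close>

lemma invertible_mat_2_iff:
  fixes A :: "'a :: field mat"
  assumes A: "A \<in> carrier_mat 2 2"
  shows "invertible_mat A \<longleftrightarrow> A $$ (0, 0) * A $$ (1, 1) \<noteq> A $$ (0, 1) * A $$ (1, 0)"
    (is "_ \<longleftrightarrow> ?a * ?d \<noteq> ?b * ?c")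
proof -
  have entry: "(X * Y) $$ (i, j) = X $$ (i, 0) * Y $$ (0, j) + X $$ (i, 1) * Y $$ (1, j)"
    if "X \<in> carrier_mat 2 2" "Y \<in> carrier_mat 2 2" "i < 2" "j < 2" for X Y :: "'a mat" and i j
    using that by (auto simp: scalar_prod_def eval_nat_numeral)
  show ?thesis
  proof
    assume "invertible_mat A"
    then obtain B where AB: "A * B = 1\<^sub>m 2" and BA: "B * A = 1\<^sub>m (dim_row B)"
      using A by (auto simp: invertible_mat_def inverts_mat_def)
    \<comment> \<open>\<open>invertible_mat\<close> does not prescribe the shape of the inverse:
      \<open>A * B\<close> determines its number of columns, \<open>B * A\<close> its number of
      rows.\<close>
    have "dim_col (A * B) = 2" "dim_col (B * A) = dim_row B"
      unfolding AB BA by simp_all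
    then have B: "B \<in> carrier_mat 2 2" using A by auto
    let ?x = "B $$ (0, 0)" and ?y = "B $$ (0, 1)" and ?z = "B $$ (1, 0)" and ?w = "B $$ (1, 1)"
    have eqs: "?a * ?x + ?b * ?z = 1" "?c * ?x + ?d * ?z = 0"
      "?a * ?y + ?b * ?w = 0" "?c * ?y + ?d * ?w = 1"
      using entry[OF A B, of 0 0] entry[OF A B, of 1 0] entry[OF A B, of 0 1] entry[OF A B, of 1 1]
      unfolding AB by simp_all
    \<comment> \<open>This is det(A B) = det A * det B written out. The left-hand side is 1 by
      \<open>eqs\<close>, so det A is nonzero.\<close>
    have "(?a * ?x + ?b * ?z) * (?c * ?y + ?d * ?w) - (?a * ?y + ?b * ?w) * (?c * ?x + ?d * ?z)
        = (?a * ?d - ?b * ?c) * (?x * ?w - ?y * ?z)"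
      by (simp add: algebra_simps)
    then show "?a * ?d \<noteq> ?b * ?c" unfolding eqs by auto
  next
    assume "?a * ?d \<noteq> ?b * ?c"
    then have det: "?a * ?d - ?b * ?c \<noteq> 0" by simp
    define D where "D = ?a * ?d - ?b * ?c"
    \<comment> \<open>\<open>B\<close> is the adjugate of \<open>A\<close> divided by the
      determinant.\<close>
    define B where "B = mat 2 2 (\<lambda>(i, j). (if i = 0 then if j = 0 then ?d else - ?b
      else if j = 0 then - ?c else ?a) / D)"
    have B: "B \<in> carrier_mat 2 2" by (simp add: B_def)
    have D: "D \<noteq> 0" using det by (simp add: D_def)
    have "A * B = 1\<^sub>m 2"
    proof (rule eq_matI)
      fix i j assume "i < dim_row (1\<^sub>m 2 :: 'a mat)" "j < dim_col (1\<^sub>m 2 :: 'a mat)"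
      then have ij: "i < 2" "j < 2" by simp_all
      then have "i = 0 \<or> i = 1" "j = 0 \<or> j = 1" by auto
      then show "(A * B) $$ (i, j) = 1\<^sub>m 2 $$ (i, j)"
        using D unfolding entry[OF A B ij]
        by (elim disjE; simp add: B_def field_simps; simp add: D_def algebra_simps)
    qed (use A B in auto)
    moreover have "B * A = 1\<^sub>m 2"
    proof (rule eq_matI)
      fix i j assume "i < dim_row (1\<^sub>m 2 :: 'a mat)" "j < dim_col (1\<^sub>m 2 :: 'a mat)"
      then have ij: "i < 2" "j < 2" by simp_all
      then have "i = 0 \<or> i = 1" "j = 0 \<or> j = 1" by auto
      then show "(B * A) $$ (i, j) = 1\<^sub>m 2 $$ (i, j)"
        using D unfolding entry[OF B A ij]
        by (elim disjE; simp add: B_def field_simps; simp add: D_def algebra_simps)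
    qed (use A B in auto)
    ultimately show "invertible_mat A"
      using A B by (auto simp: invertible_mat_def inverts_mat_def)
  qed
qed

text \<open>Not the minor itself but the indicator that it is nonzero, real-valued so that it can be
  summed. Indices may coincide or decrease.\<close>

definition minor :: "bit mat \<Rightarrow> nat \<Rightarrow> nat \<Rightarrow> nat \<Rightarrow> nat \<Rightarrow> real" where
  "minor M a b j k = of_bool (M $$ (a, j) * M $$ (b, k) \<noteq> M $$ (a, k) * M $$ (b, j))"

lemma minor_same_row [simp]: "minor M a a j k = 0"
  by (simp add: minor_def mult.commute)

lemma minor_same_col [simp]: "minor M a b j j = 0"
  by (simp add: minor_def)

lemma minor_swap_rows: "minor M b a j k = minor M a b j k"
proof -
  have "M $$ (b, j) * M $$ (a, k) \<noteq> M $$ (b, k) * M $$ (a, j)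
      \<longleftrightarrow> M $$ (a, j) * M $$ (b, k) \<noteq> M $$ (a, k) * M $$ (b, j)"
    by (metis mult.commute)
  then show ?thesis by (simp only: minor_def)
qed

lemma minor_swap_cols: "minor M a b k j = minor M a b j k"
  unfolding minor_def by (simp only: eq_commute[of "M $$ (a, k) * M $$ (b, j)"])

lemma pick_doubleton:
  assumes "a < b"
  shows "pick {a, b} 0 = a" "pick {a, b} (Suc 0) = b"
proof -
  show *: "pick {a, b} 0 = a"
    using assms by (auto intro!: Least_equality)
  show "pick {a, b} (Suc 0) = b"
    using assms * by (auto intro!: Least_equality)
qed

text \<open>\<open>submatrix\<close> lists its index sets in increasing order through
  \<open>pick\<close>, so increasing indices are treated first.\<close>

lemma invertible_submatrix_ordered:
  assumes "a < b" "b < dim_row M" "j < k" "k < dim_col M"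
  shows "of_bool (invertible_mat (submatrix M {a, b} {j, k})) = minor M a b j k"
proof -
  have "{i. i < dim_row M \<and> i \<in> {a, b}} = {a, b}" "{i. i < dim_col M \<and> i \<in> {j, k}} = {j, k}"
    using assms by auto
  then have "submatrix M {a, b} {j, k} = mat 2 2 (\<lambda>(p, q). M $$ (pick {a, b} p, pick {j, k} q))"
    using assms by (simp add: submatrix_def numeral_2_eq_2)
  then show ?thesis
    using pick_doubleton[OF assms(1)] pick_doubleton[OF assms(3)]
    by (simp add: invertible_mat_2_iff minor_def del: pick.simps)
qed

text \<open>Index sets forget the order, and \<open>minor\<close> is invariant under both swaps, so
  everything reduces to increasing indices.\<close>

lemma invertible_submatrix:
  assumes "a \<noteq> b" "a < dim_row M" "b < dim_row M" "j \<noteq> k" "j < dim_col M" "k < dim_col M"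
  shows "of_bool (invertible_mat (submatrix M {a, b} {j, k})) = minor M a b j k"
proof -
  have cols: "of_bool (invertible_mat (submatrix M {a, b} {j, k})) = minor M a b j k"
    if "a < b" "b < dim_row M" for a b
    using invertible_submatrix_ordered[OF that, of j k] invertible_submatrix_ordered[OF that, of k j]
      assms(4-6) by (cases "j < k") (simp_all add: insert_commute[of k j] minor_swap_cols[of M a b k j])
  show ?thesis
    using cols[of a b] cols[of b a] assms(1-3)
    by (cases "a < b") (simp_all add: insert_commute[of b a] minor_swap_rows[of M b a])
qed

text \<open>Index pairs are ordered, so each submatrix counts four times; coinciding indices contribute zero.\<close>

lemma sum_minor_eq_N2:
  "(\<Sum>a<dim_row M. \<Sum>b<dim_row M. \<Sum>j<dim_col M. \<Sum>k<dim_col M. minor M a b j k) = 4 * real (N2 M)"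
proof -
  let ?P = "\<lambda>n. {I. I \<subseteq> {..<n} \<and> card I = 2}"
  let ?inv = "\<lambda>I J. of_bool (invertible_mat (submatrix M I J)) :: real"
  have cols: "(\<Sum>j<dim_col M. \<Sum>k<dim_col M. minor M a b j k)
      = 2 * (\<Sum>J\<in>?P (dim_col M). ?inv {a, b} J)"
    if "a < dim_row M" "b < dim_row M" "a \<noteq> b" for a b
    using that by (intro sum_ordered_pairs) (auto simp: invertible_submatrix)
  have "(\<Sum>a<dim_row M. \<Sum>b<dim_row M. \<Sum>j<dim_col M. \<Sum>k<dim_col M. minor M a b j k)
      = 2 * (\<Sum>I\<in>?P (dim_row M). 2 * (\<Sum>J\<in>?P (dim_col M). ?inv I J))"
    by (rule sum_ordered_pairs) (auto simp: cols)
  also have "\<dots> = 4 * (\<Sum>I\<in>?P (dim_row M). \<Sum>J\<in>?P (dim_col M). ?inv I J)"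
    by (simp flip: sum_distrib_left)
  also have "(\<Sum>I\<in>?P (dim_row M). \<Sum>J\<in>?P (dim_col M). ?inv I J)
      = (\<Sum>p\<in>?P (dim_row M) \<times> ?P (dim_col M). ?inv (fst p) (snd p))"
    by (simp only: sum.cartesian_product case_prod_unfold)
  also have "\<dots> = real (card {p \<in> ?P (dim_row M) \<times> ?P (dim_col M).
      invertible_mat (submatrix M (fst p) (snd p))})"
    by (simp add: of_bool_def sum.If_cases Int_def)
  also have "{p \<in> ?P (dim_row M) \<times> ?P (dim_col M). invertible_mat (submatrix M (fst p) (snd p))}
      = {(I, J). I \<subseteq> {..<dim_row M} \<and> card I = 2 \<and> J \<subseteq> {..<dim_col M} \<and> card J = 2 \<and>
          invertible_mat (submatrix M I J)}"
    by auto
  finally show ?thesis by (simp add: N2_def)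
qed

section \<open>Pairs of columns of height four and the entries of C\<close>

text \<open>Columns are functions rather than vectors, so that a column can be read along any
  enumeration of four rows.\<close>

definition col_pair_sum :: "(nat \<Rightarrow> bit) \<Rightarrow> (nat \<Rightarrow> bit) \<Rightarrow> real" where
  "col_pair_sum x y = (\<Sum>p<4. \<Sum>q<4. of_bool (x p * y q \<noteq> y p * x q))"

lemma col_pair_sum_cong:
  assumes "\<And>p. p < 4 \<Longrightarrow> x p = x' p" "\<And>p. p < 4 \<Longrightarrow> y p = y' p"
  shows "col_pair_sum x y = col_pair_sum x' y'"
  unfolding col_pair_sum_def using assms by (intro sum.cong refl) auto

text \<open>Summing \<open>minor\<close> over ordered row and column pairs of the 4 by 2 matrix
  gives four times \<open>c i j\<close>. The two orders of the columns account for one factor 2; the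
  order of the rows leaves the other.\<close>

lemma col_pair_sum_bvec: "col_pair_sum (($) (bvec i)) (($) (bvec j)) = 2 * real (c i j)"
proof -
  define M where "M = mat_of_cols 4 [bvec i, bvec j]"
  have M: "dim_row M = 4" "dim_col M = 2" by (simp_all add: M_def)
  have "M $$ (p, 0) = bvec i $ p" "M $$ (p, 1) = bvec j $ p" if "p < 4" for p
    using that by (simp_all add: M_def mat_of_cols_index)
  then have "minor M p q 0 1 = of_bool (bvec i $ p * bvec j $ q \<noteq> bvec j $ p * bvec i $ q)"
    if "p < 4" "q < 4" for p q
    using that by (simp add: minor_def)
  then have "col_pair_sum (($) (bvec i)) (($) (bvec j)) = (\<Sum>p<4. \<Sum>q<4. minor M p q 0 1)"
    unfolding col_pair_sum_def by (intro sum.cong refl) simp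
  moreover have "(\<Sum>j<2. \<Sum>k<2. minor M p q j k) = 2 * minor M p q 0 1" for p q
    by (simp add: eval_nat_numeral minor_swap_cols[of M p q "Suc 0" 0])
  then have "(\<Sum>p<4. \<Sum>q<4. 2 * minor M p q 0 1) = 4 * real (c i j)"
    using sum_minor_eq_N2[of M] by (simp add: M c_def flip: M_def)
  ultimately show ?thesis by (simp flip: sum_distrib_left)
qed

lemma bvec_0: "p < 4 \<Longrightarrow> bvec 0 $ p = 0"
  by (simp add: bvec_def)

text \<open>\<open>bvec 0\<close> is the zero column, which lies in no invertible submatrix. Hence
  the indices 1 to 15 suffice in the program.\<close>

lemma c_0 [simp]: "c 0 j = 0" "c i 0 = 0"
  using col_pair_sum_bvec[of 0 j] col_pair_sum_bvec[of i 0]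
  by (simp_all add: col_pair_sum_def bvec_0)

lemma bvec_surj:
  fixes x :: "nat \<Rightarrow> bit"
  obtains i where "i < 16" "\<And>p. p < 4 \<Longrightarrow> bvec i $ p = x p"
proof -
  \<comment> \<open>The bits read as a binary numeral, most significant first as in
    \<open>bvec\<close>.\<close>
  define i :: nat where "i = 8 * of_bool (x 0 = 1) + 4 * of_bool (x 1 = 1)
    + 2 * of_bool (x 2 = 1) + of_bool (x 3 = 1)"
  have "bvec i $ p = x p" if "p < 4" for p
  proof -
    have "p = 0 \<or> p = 1 \<or> p = 2 \<or> p = 3" using that by arith
    then show ?thesis
      by (elim disjE) (auto simp: bvec_def i_def bit_iff_odd of_bool_def)
  qed
  moreover have "i < 16" by (auto simp: i_def)
  ultimately show thesis using that by blast
qed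

section \<open>The quadratic program\<close>

lemma Q_objective_eq:
  assumes "z \<in> carrier_vec 15"
  shows "Q_objective z = 1 / 2 * (\<Sum>i<15. \<Sum>j<15. z $ i * z $ j * real (c (Suc i) (Suc j)))"
proof -
  have "z \<bullet> (Cmat *\<^sub>v z) = (\<Sum>i<15. z $ i * (\<Sum>j<15. real (c (Suc i) (Suc j)) * z $ j))"
    using assms by (simp add: scalar_prod_def Cmat_def atLeast0LessThan)
  also have "\<dots> = (\<Sum>i<15. \<Sum>j<15. z $ i * z $ j * real (c (Suc i) (Suc j)))"
    unfolding sum_distrib_left by (simp only: mult_ac)
  finally show ?thesis by (simp add: Q_objective_def)
qed

text \<open>The supremum is an upper bound once the objective is bounded above. Feasibility puts
  every coordinate in [0, 1], so half the sum of the entries of \<open>Cmat\<close> is a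
  bound.\<close>

lemma Q_objective_le_optimum:
  assumes "z \<in> Q_feasible"
  shows "Q_objective z \<le> Q_optimum"
  unfolding Q_optimum_def
proof (rule cSUP_upper[OF assms])
  let ?B = "1 / 2 * (\<Sum>i<15. \<Sum>j<15. real (c (Suc i) (Suc j)))"
  have "Q_objective z \<le> ?B" if z: "z \<in> Q_feasible" for z
  proof -
    have nonneg: "0 \<le> z $ i" if "i < 15" for i
      using z that by (auto simp: Q_feasible_def)
    have le1: "z $ i \<le> 1" if "i < 15" for i
    proof -
      have "z $ i \<le> (\<Sum>i<15. z $ i)"
        using that nonneg by (intro member_le_sum) auto
      then show ?thesis using z by (auto simp: Q_feasible_def)
    qed
    have "z $ i * z $ j * real (c (Suc i) (Suc j)) \<le> real (c (Suc i) (Suc j))"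
      if "i < 15" "j < 15" for i j
      using that nonneg le1 mult_le_one[of "z $ i" "z $ j"]
      by (intro mult_left_le_one_le) auto
    then have "(\<Sum>i<15. \<Sum>j<15. z $ i * z $ j * real (c (Suc i) (Suc j)))
        \<le> (\<Sum>i<15. \<Sum>j<15. real (c (Suc i) (Suc j)))"
      by (intro sum_mono) auto
    then show ?thesis
      using z by (simp add: Q_objective_eq Q_feasible_def)
  qed
  then show "bdd_above (Q_objective ` Q_feasible)"
    by (intro bdd_aboveI2)
qed

text \<open>The factor 4 is composed of the 2 relating \<open>col_pair_sum\<close> to
  \<open>c\<close> and the 2 that cancels the 1/2 in the objective.\<close>

lemma sum_col_pairs_le:
  fixes u :: "nat \<Rightarrow> nat \<Rightarrow> bit"
  assumes s: "0 < s"
  shows "(\<Sum>j<s. \<Sum>k<s. col_pair_sum (u j) (u k)) \<le> 4 * (real s)\<^sup>2 * Q_optimum"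
proof -
  have "\<forall>j. \<exists>i<16. \<forall>p<4. bvec i $ p = u j p"
    using bvec_surj by metis
  then obtain t where t: "\<And>j. t j < (16::nat)" "\<And>j p. p < 4 \<Longrightarrow> bvec (t j) $ p = u j p"
    by metis
  define n where "n i = real (card {j \<in> {..<s}. t j = i})" for i
  \<comment> \<open>Type 0 is split off and the others are shifted, because position
    \<open>i\<close> of \<open>z\<close> stands for type \<open>Suc i\<close>.\<close>
  have classify: "(\<Sum>j<s. G (t j)) = G 0 * n 0 + (\<Sum>i<15. n (Suc i) * G (Suc i))" for G :: "nat \<Rightarrow> real"
  proof -
    have "(\<Sum>j<s. G (t j)) = (\<Sum>i<16. n i * G i)"
      unfolding n_def using t(1) by (intro sum_fun_comp) auto
    also have "{..<16::nat} = {..<Suc 15}" by simp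
    finally show ?thesis by (simp only: sum.lessThan_Suc_shift) (simp add: mult.commute)
  qed
  define z where "z = vec 15 (\<lambda>i. n (Suc i) / real s)"
  \<comment> \<open>The coordinates of \<open>z\<close> thus sum to 1 - \<open>n 0\<close> /
    \<open>s\<close>: zero columns make up the slack in the constraint.\<close>
  have "n 0 + (\<Sum>i<15. n (Suc i)) = real s"
    using classify[of "\<lambda>_. 1"] by simp
  moreover have "0 \<le> n i" for i by (simp add: n_def)
  ultimately have z: "z \<in> Q_feasible"
    using s by (auto simp: Q_feasible_def z_def divide_le_eq simp flip: sum_divide_distrib)
      (metis le_add_same_cancel2)
  have "(\<Sum>j<s. \<Sum>k<s. col_pair_sum (u j) (u k)) = (\<Sum>j<s. \<Sum>k<s. 2 * real (c (t j) (t k)))"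
    unfolding col_pair_sum_bvec[symmetric] using t(2) by (intro sum.cong col_pair_sum_cong) auto
  also have "\<dots> = 2 * (\<Sum>j<s. \<Sum>k<s. real (c (t j) (t k)))"
    by (simp flip: sum_distrib_left)
  \<comment> \<open>Classifying first the second column, then the first; each time the type 0 term
    vanishes by \<open>c_0\<close>.\<close>
  also have "(\<Sum>j<s. \<Sum>k<s. real (c (t j) (t k)))
      = (\<Sum>j<s. \<Sum>k<15. n (Suc k) * real (c (t j) (Suc k)))"
    by (rule sum.cong[OF refl]) (subst classify, simp)
  also have "\<dots> = (\<Sum>i<15. n (Suc i) * (\<Sum>k<15. n (Suc k) * real (c (Suc i) (Suc k))))"
    by (subst classify[where G = "\<lambda>i. \<Sum>k<15. n (Suc k) * real (c i (Suc k))"]) simp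
  also have "\<dots> = (\<Sum>i<15. \<Sum>k<15. (real s)\<^sup>2 * (z $ i * z $ k * real (c (Suc i) (Suc k))))"
    unfolding sum_distrib_left using s
    by (intro sum.cong refl) (simp add: z_def power2_eq_square)
  also have "\<dots> = (real s)\<^sup>2 * (2 * Q_objective z)"
    using z by (simp add: Q_objective_eq Q_feasible_def sum_distrib_left)
  also have "2 * ((real s)\<^sup>2 * (2 * Q_objective z)) \<le> 2 * ((real s)\<^sup>2 * (2 * Q_optimum))"
    using Q_objective_le_optimum[OF z] by (intro mult_left_mono) auto
  finally show ?thesis by simp
qed

section \<open>Averaging over the 4-subsets of the rows\<close>

text \<open>Removing \<open>a\<close> and \<open>b\<close> leaves an arbitrary 2-subset of the other
  \<open>s - 2\<close> indices.\<close>

lemma card_4_subsets_containing_pair: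
  assumes "a < s" "b < s" "a \<noteq> b"
  shows "card {S. S \<subseteq> {..<s} \<and> card S = 4 \<and> a \<in> S \<and> b \<in> S} = (s - 2) choose 2"
proof -
  let ?R = "{..<s} - {a, b}"
  have fin: "finite T" if "T \<subseteq> {..<s}" for T using that by (rule finite_subset) simp
  have "bij_betw (\<lambda>T. T \<union> {a, b}) {T. T \<subseteq> ?R \<and> card T = 2}
    {S. S \<subseteq> {..<s} \<and> card S = 4 \<and> a \<in> S \<and> b \<in> S}"
  proof (rule bij_betw_byWitness[where f' = "\<lambda>S. S - {a, b}"])
    show "(\<lambda>T. T \<union> {a, b}) ` {T. T \<subseteq> ?R \<and> card T = 2}
        \<subseteq> {S. S \<subseteq> {..<s} \<and> card S = 4 \<and> a \<in> S \<and> b \<in> S}"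
    proof safe
      fix T assume T: "T \<subseteq> ?R" "card T = 2"
      then have "finite T" by (auto intro: fin)
      then have "card (T \<union> {a, b}) = card T + card {a, b}"
        using T by (intro card_Un_disjoint) auto
      then show "card (T \<union> {a, b}) = 4" using T assms by simp
    qed (use assms in auto)
    show "(\<lambda>S. S - {a, b}) ` {S. S \<subseteq> {..<s} \<and> card S = 4 \<and> a \<in> S \<and> b \<in> S}
        \<subseteq> {T. T \<subseteq> ?R \<and> card T = 2}"
      using assms fin by (auto simp: card_Diff_subset)
  qed auto
  then have "card {S. S \<subseteq> {..<s} \<and> card S = 4 \<and> a \<in> S \<and> b \<in> S} = card {T. T \<subseteq> ?R \<and> card T = 2}"
    by (rule bij_betw_same_card[symmetric])
  also have "\<dots> = card ?R choose 2" by (rule n_subsets) simp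
  finally show ?thesis using assms by (simp add: card_Diff_subset numeral_2_eq_2)
qed

text \<open>Double counting: after exchanging the sums, \<open>f a b\<close> is weighted by the
  number of 4-subsets containing both indices. For \<open>a = b\<close> this number differs in
  general, so the diagonal has to vanish.\<close>

lemma sum_4_subsets_pairs:
  fixes f :: "nat \<Rightarrow> nat \<Rightarrow> real"
  assumes diag: "\<And>a. f a a = 0"
  shows "(\<Sum>S | S \<subseteq> {..<s} \<and> card S = 4. \<Sum>a\<in>S. \<Sum>b\<in>S. f a b)
    = real ((s - 2) choose 2) * (\<Sum>a<s. \<Sum>b<s. f a b)"
proof -
  let ?F = "{S. S \<subseteq> {..<s} \<and> card S = 4}"
  have "(\<Sum>S\<in>?F. \<Sum>a\<in>S. \<Sum>b\<in>S. f a b)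
      = (\<Sum>S\<in>?F. \<Sum>a<s. \<Sum>b<s. of_bool (a \<in> S \<and> b \<in> S) * f a b)"
  proof (rule sum.cong[OF refl])
    fix S assume "S \<in> ?F"
    then have "S \<subseteq> {..<s}" by simp
    then have *: "(\<Sum>a<s. of_bool (a \<in> S) * g a) = (\<Sum>a\<in>S. g a)" for g :: "nat \<Rightarrow> real"
      by (intro sum.mono_neutral_cong_right) auto
    have "(\<Sum>a<s. \<Sum>b<s. of_bool (a \<in> S \<and> b \<in> S) * f a b)
        = (\<Sum>a<s. of_bool (a \<in> S) * (\<Sum>b<s. of_bool (b \<in> S) * f a b))"
      by (simp only: of_bool_conj sum_distrib_left mult.assoc)
    then show "(\<Sum>a\<in>S. \<Sum>b\<in>S. f a b) = (\<Sum>a<s. \<Sum>b<s. of_bool (a \<in> S \<and> b \<in> S) * f a b)"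
      by (simp only: *)
  qed
  also have "\<dots> = (\<Sum>a<s. \<Sum>b<s. \<Sum>S\<in>?F. of_bool (a \<in> S \<and> b \<in> S) * f a b)"
    by (subst sum.swap) (intro sum.cong refl sum.swap)
  also have "\<dots> = (\<Sum>a<s. \<Sum>b<s. real ((s - 2) choose 2) * f a b)"
  proof (intro sum.cong refl)
    fix a b assume ab: "a \<in> {..<s}" "b \<in> {..<s}"
    show "(\<Sum>S\<in>?F. of_bool (a \<in> S \<and> b \<in> S) * f a b) = real ((s - 2) choose 2) * f a b"
    proof (cases "a = b")
      case True
      then show ?thesis by (simp add: diag)
    next
      case False
      have "(\<Sum>S\<in>?F. of_bool (a \<in> S \<and> b \<in> S) :: real) = real (card {S \<in> ?F. a \<in> S \<and> b \<in> S})"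
        by (simp add: of_bool_def sum.If_cases Int_def)
      also have "{S \<in> ?F. a \<in> S \<and> b \<in> S} = {S. S \<subseteq> {..<s} \<and> card S = 4 \<and> a \<in> S \<and> b \<in> S}"
        by auto
      finally show ?thesis
        using card_4_subsets_containing_pair False ab by (simp flip: sum_distrib_right)
    qed
  qed
  finally show ?thesis by (simp add: sum_distrib_left)
qed

text \<open>Any enumeration \<open>e\<close> of \<open>S\<close> will do, increasing or not, since
  ordered row pairs are summed. Moving the column sums outside exposes \<open>col_pair_sum\<close>
  for each ordered pair of columns.\<close>

lemma sum_minor_4_rows_le:
  assumes s: "0 < s" and S: "card S = 4"
  shows "(\<Sum>a\<in>S. \<Sum>b\<in>S. \<Sum>j<s. \<Sum>k<s. minor M a b j k) \<le> 4 * (real s)\<^sup>2 * Q_optimum"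
proof -
  have "finite S" using S card.infinite by fastforce
  then obtain e where e: "bij_betw e {..<4::nat} S"
    using ex_bij_betw_nat_finite[of S] S by (auto simp: atLeast0LessThan)
  have "(\<Sum>a\<in>S. \<Sum>b\<in>S. \<Sum>j<s. \<Sum>k<s. minor M a b j k)
      = (\<Sum>p<4. \<Sum>q<4. \<Sum>j<s. \<Sum>k<s. minor M (e p) (e q) j k)"
    by (simp add: sum.reindex_bij_betw[OF e, symmetric])
  also have "\<dots> = (\<Sum>p<4. \<Sum>j<s. \<Sum>q<4. \<Sum>k<s. minor M (e p) (e q) j k)"
    by (intro sum.cong refl sum.swap)
  also have "\<dots> = (\<Sum>p<4. \<Sum>j<s. \<Sum>k<s. \<Sum>q<4. minor M (e p) (e q) j k)"
    by (intro sum.cong refl sum.swap)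
  also have "\<dots> = (\<Sum>j<s. \<Sum>p<4. \<Sum>k<s. \<Sum>q<4. minor M (e p) (e q) j k)"
    by (rule sum.swap)
  also have "\<dots> = (\<Sum>j<s. \<Sum>k<s. \<Sum>p<4. \<Sum>q<4. minor M (e p) (e q) j k)"
    by (intro sum.cong refl sum.swap)
  also have "\<dots> = (\<Sum>j<s. \<Sum>k<s. col_pair_sum (\<lambda>p. M $$ (e p, j)) (\<lambda>p. M $$ (e p, k)))"
    by (simp add: col_pair_sum_def minor_def)
  finally show ?thesis using sum_col_pairs_le[OF s] by simp
qed

text \<open>Both sides count the 4-subsets with a marked 2-subset.\<close>

lemma choose_4_times_6: "(s choose 4) * 6 = (s choose 2) * ((s - 2) choose 2)" if "4 \<le> s"
proof -
  have "(4 choose 2 :: nat) = 6" by (simp add: choose_two)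
  then show ?thesis using choose_mult[of 2 4 s] that by simp
qed

section \<open>The bound for a single matrix and for the maximum\<close>

lemma R2_mat_le:
  assumes s: "4 \<le> s" and M: "M \<in> carrier_mat s s"
  shows "R2_mat M \<le> Q_optimum * real s / (3 * (real s - 1))"
proof -
  let ?F = "{S. S \<subseteq> {..<s} \<and> card S = 4}"
  define B D where "B = real (s choose 2)" and "D = real ((s - 2) choose 2)"
  have B: "B = real s * (real s - 1) / 2"
    using s by (simp add: B_def choose_two of_nat_diff real_of_nat_div)
  have pos: "0 < B" "0 < D" using s by (simp_all add: B_def D_def)
  \<comment> \<open>\<open>D\<close> counts the 4-subsets containing a given row pair; the 4 comes
    from ordering rows and columns.\<close>
  have "D * (4 * real (N2 M)) = (\<Sum>S\<in>?F. \<Sum>a\<in>S. \<Sum>b\<in>S. \<Sum>j<s. \<Sum>k<s. minor M a b j k)"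
    using sum_minor_eq_N2[of M] M by (subst sum_4_subsets_pairs) (simp_all add: D_def)
  also have "\<dots> \<le> (\<Sum>S\<in>?F. 4 * (real s)\<^sup>2 * Q_optimum)"
    using s by (intro sum_mono sum_minor_4_rows_le) auto
  also have "\<dots> = real (s choose 4) * (4 * (real s)\<^sup>2 * Q_optimum)"
    by (simp add: n_subsets)
  \<comment> \<open>This form exposes the factor \<open>D\<close>, which then cancels.\<close>
  also have "real (s choose 4) = B * D / 6"
    using choose_4_times_6[OF s, THEN arg_cong[where f = real]] by (simp add: B_def D_def)
  finally have "D * real (N2 M) \<le> D * (B * ((real s)\<^sup>2 * Q_optimum / 6))"
    by (simp add: mult_ac)
  then have "real (N2 M) \<le> B * ((real s)\<^sup>2 * Q_optimum / 6)"
    using pos by simp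
  then have "real (N2 M) / B\<^sup>2 \<le> B * ((real s)\<^sup>2 * Q_optimum / 6) / B\<^sup>2"
    by (rule divide_right_mono) simp
  moreover have "R2_mat M = real (N2 M) / B\<^sup>2"
    using M by (simp add: R2_mat_def B_def)
  moreover have "B * ((real s)\<^sup>2 * Q_optimum / 6) / B\<^sup>2 = (real s)\<^sup>2 * Q_optimum / 6 / B"
    using pos by (simp add: power2_eq_square)
  moreover have "(real s)\<^sup>2 * Q_optimum / 6 / B = Q_optimum * real s / (3 * (real s - 1))"
    using s unfolding B by (simp add: power2_eq_square)
  ultimately show ?thesis by simp
qed

text \<open>A crude bound, serving to make the set of values in \<open>R2\<close> finite so that its
  \<open>Max\<close> is meaningful.\<close>

lemma N2_le: "N2 M \<le> 2 ^ dim_row M * 2 ^ dim_col M"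
proof -
  have "N2 M \<le> card (Pow {..<dim_row M} \<times> Pow {..<dim_col M})"
    unfolding N2_def by (intro card_mono) auto
  then show ?thesis by (simp add: card_cartesian_product card_Pow)
qed

theorem theorem4p3:
  fixes s :: nat
  assumes "4 \<le> s"
  shows "R2 s \<le> Q_optimum * real s / (3 * (real s - 1))"
proof -
  let ?V = "{R2_mat M | M. M \<in> carrier_mat s s \<and> invertible_mat M}"
  have "?V \<subseteq> (\<lambda>n. real n / (real (s choose 2))\<^sup>2) ` {..2 ^ s * 2 ^ s}"
  proof safe
    fix M :: "bit mat" assume M: "M \<in> carrier_mat s s"
    then have "N2 M \<le> 2 ^ s * 2 ^ s" using N2_le[of M] by simp
    then show "R2_mat M \<in> (\<lambda>n. real n / (real (s choose 2))\<^sup>2) ` {..2 ^ s * 2 ^ s}"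
      using M by (auto simp: R2_mat_def)
  qed
  then have "finite ?V" by (rule finite_subset) simp
  \<comment> \<open>The identity matrix shows that the maximum is over a nonempty set.\<close>
  moreover have "invertible_mat (1\<^sub>m s :: bit mat)"
    by (auto simp: invertible_mat_def inverts_mat_def intro!: exI[of _ "1\<^sub>m s"])
  then have "?V \<noteq> {}" using one_carrier_mat by blast
  ultimately show ?thesis
    unfolding R2_def using R2_mat_le[OF assms] by (subst Max_le_iff) auto
qed

end
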